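(* Suppose that $\sigma(t,x)=\sigma(t)$ and $$f(t,x_j,u_j,m)=\bar f(t,x_j,m)+B(t,x_j,m)\,u_j,\qquad c(t,x_j,u_j,m)=\bar c(t,x_j,m)+\|u_j\|^2 .$$ Then the best-response control of Player $j$ to the given mean-field trajectory $m^n$ is $$\bar\gamma^{n,*}_j=-\tfrac12 B'\,\partial_{x_j}v^n,$$ where $B=B(t,x_j,m^n_t)$ and $v^n$ is the (twice continuously differentiable) risk-sensitive value function of Player $j$ with respect to $m^n$.
   Context: Fix $T>0$, $\epsilon>0$, $\delta>0$. A prime denotes transpose; gradients are column vectors. The state of Player $j$ in $\mathbb{R}^k$ follows $$dx_j^n(t)=f(t,x_j^n(t),u_j^n(t),m^n_t)\,dt+\sqrt{\epsilon}\,\sigma(t)\,d\mathbb{B}_j(t),$$ where $\mathbb{B}_j$ are mutually independent standard Brownian motions in $\mathbb{R}^k$, $m^n_t=\frac1n\sum_{i=1}^n\delta_{x_i^n(t)}$ is the empirical measure of the $n$ players' states, and $f(t,x,u,m)=\int_wf(t,x,u,w)\,m(dw)$ is the drift averaged against $m$. In Player $j$'s best-response problem, $m^n=(m^n_t)_{t\in[0,T]}$ is a given exogenous trajectory. Controls $u_j$ take values in $U_j\subseteq\mathbb{R}^{p_j}$ and are generated by admissible individual state-feedback strategies $\bar\gamma_j:[0,T]\times\mathbb{R}^k\to U_j$, under which the state equation has a unique solution; $\bar\Gamma_j$ is the set of these. The risk-sensitive cost is $$L(\bar\gamma_j,m^n_{[t,T]};t,\underline{x},\underline{m})=\delta\log\mathbb{E}\Big(e^{\frac1\delta[g(x^n_j(T))+\int_t^Tc(s,x_j^n(s),u_j^n(s),m^n_s)\,ds]}\Big|x_j^n(t)=\underline{x},\,m^n_t=\underline{m}\Big).$$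 A best response to $m^n$ is a strategy minimizing $L(\cdot,m^n_{[0,T]};0,x_{j,0},\underline{m})$ over $\bar\Gamma_j$, where $x_{j,0}$ and $\underline m$ are the initial values of $x_j^n$ and $m^n$. The value function is $v^n(t,x_j,\underline m)=\inf_{u_j}L(u_j,m^n_{[t,T]};t,x_j,\underline m)$; when it is twice continuously differentiable it satisfies, along the given $m^n$, $$\partial_tv^n+\inf_{u_j}\Big\{f\cdot\partial_{x_j}v^n+\frac\epsilon2\mathrm{tr}(\sigma\sigma'\partial^2_{x_jx_j}v^n)+\frac{\epsilon}{2\delta}\|\sigma'\partial_{x_j}v^n\|^2+c\Big\}=0,\quad v^n(T,x_j)=g(x_j),$$ and any strategy attaining the minimum in this equation is a best response to $m^n$. Standing assumptions: $f$ is $C^1$ in $(t,x,u,m)$ and Lipschitz in $(x,u,m)$; the entries of $\sigma$ are $C^2$ and $\sigma\sigma'$ is strictly positive; $f,\partial_xf$ are uniformly bounded; $U_j$ is non-empty, closed and bounded; $\bar\gamma_j$ is piecewise continuous in $t$ and Lipschitz in $x$; $c$ is $C^1$ in $(t,x,u,m)$, $g$ is $C^2$ in $x$, and $c,g$ are non-negative; $c,\partial_xc,g,\partial_xg$ are uniformly bounded.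
   Formalization: The formal statement additionally assumes that the feedback −½B'∂v^n is itself an admissible strategy (in particular takes values in the bounded set U_j); without this it may leave U_j and the claim fails, e.g. for U_j={0}. *)

theory Defs
  imports "HOL-Probability.Probability"
begin

text \<open>On a closed set the derivative is taken within the set, and some choice of it has to be
  continuous.\<close>

definition C1_on :: "'a::real_normed_vector set \<Rightarrow> ('a \<Rightarrow> 'b::real_normed_vector) \<Rightarrow> bool" where
  "C1_on S h \<longleftrightarrow> (\<exists>h' :: 'a \<Rightarrow> ('a \<Rightarrow>\<^sub>L 'b).
     (\<forall>z\<in>S. (h has_derivative blinfun_apply (h' z)) (at z within S)) \<and> continuous_on S h')"

definition C2_on :: "'a::real_normed_vector set \<Rightarrow> ('a \<Rightarrow> 'b::real_normed_vector) \<Rightarrow> bool" where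
  "C2_on S h \<longleftrightarrow> (\<exists>h' :: 'a \<Rightarrow> ('a \<Rightarrow>\<^sub>L 'b).
     (\<forall>z\<in>S. (h has_derivative blinfun_apply (h' z)) (at z within S)) \<and> C1_on S h')"

definition piecewise_continuous_on_interval ::
    "real \<Rightarrow> real \<Rightarrow> (real \<Rightarrow> 'a::topological_space) \<Rightarrow> bool" where
  "piecewise_continuous_on_interval a b h \<longleftrightarrow>
     (\<exists>S. finite S \<and> continuous_on ({a..b} - S) h) \<and>
     (\<forall>s\<in>{a<..b}. \<exists>l. (h \<longlongrightarrow> l) (at_left s)) \<and>
     (\<forall>s\<in>{a..<b}. \<exists>l. (h \<longlongrightarrow> l) (at_right s))"

text \<open>The function \<open>v\<close> of time and state is once continuously differentiable in time and twice
  in the state, with time derivative \<open>vt\<close>, gradient \<open>vx\<close> and Hessian \<open>vxx\<close>.  A function that is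
  jointly twice continuously differentiable has this property.\<close>

definition C12_with_derivatives ::
    "real \<Rightarrow> (real \<Rightarrow> real^'k \<Rightarrow> real) \<Rightarrow> (real \<Rightarrow> real^'k \<Rightarrow> real) \<Rightarrow>
     (real \<Rightarrow> real^'k \<Rightarrow> real^'k) \<Rightarrow> (real \<Rightarrow> real^'k \<Rightarrow> real^'k^'k) \<Rightarrow> bool" where
  "C12_with_derivatives T v vt vx vxx \<longleftrightarrow>
     (\<forall>t\<in>{0..T}. \<forall>x.
        ((\<lambda>s. v s x) has_real_derivative vt t x) (at t within {0..T}) \<and>
        GDERIV (v t) x :> vx t x \<and>
        (vx t has_derivative (\<lambda>h. vxx t x *v h)) (at x)) \<and>
     continuous_on ({0..T} \<times> UNIV) (\<lambda>(t, x). v t x) \<and>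
     continuous_on ({0..T} \<times> UNIV) (\<lambda>(t, x). vt t x) \<and>
     continuous_on ({0..T} \<times> UNIV) (\<lambda>(t, x). vx t x) \<and>
     continuous_on ({0..T} \<times> UNIV) (\<lambda>(t, x). vxx t x)"

definition standard_brownian_motion :: "'w measure \<Rightarrow> (real \<Rightarrow> 'w \<Rightarrow> real^'k) \<Rightarrow> bool" where
  "standard_brownian_motion M W \<longleftrightarrow>
     (\<forall>t\<ge>0. W t \<in> borel_measurable M) \<and>
     (AE \<omega> in M. W 0 \<omega> = 0) \<and>
     (AE \<omega> in M. continuous_on {0..} (\<lambda>t. W t \<omega>)) \<and>
     (\<forall>s t. 0 \<le> s \<and> s < t \<longrightarrow>
        distributed M lborel (\<lambda>\<omega>. W t \<omega> - W s \<omega>)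
          (\<lambda>z. ennreal (\<Prod>i\<in>UNIV. normal_density 0 (sqrt (t - s)) (z $ i)))) \<and>
     (\<forall>N \<tau>. 0 \<le> \<tau> 0 \<and> mono \<tau> \<longrightarrow>
        prob_space.indep_vars M (\<lambda>_. borel)
          (\<lambda>i \<omega>. W (\<tau> (Suc i)) \<omega> - W (\<tau> i) \<omega>) {..<N::nat})"

text \<open>\<open>I\<close> is (a version of) the Ito integral from \<open>a\<close> to \<open>b\<close> of the deterministic continuous
  integrand \<open>\<sigma>\<close>: the mean-square limit of the left-point Riemann sums.\<close>

definition has_ito_integral ::
    "'w measure \<Rightarrow> (real \<Rightarrow> 'w \<Rightarrow> real^'k) \<Rightarrow> (real \<Rightarrow> real^'k^'k) \<Rightarrow> real \<Rightarrow> real \<Rightarrow>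
     ('w \<Rightarrow> real^'k) \<Rightarrow> bool" where
  "has_ito_integral M W \<sigma> a b I \<longleftrightarrow>
     I \<in> borel_measurable M \<and>
     (\<lambda>N. \<integral>\<^sup>+ \<omega>. ennreal ((norm
        ((\<Sum>i<N. \<sigma> (a + real i * (b - a) / real N) *v
            (W (a + real (Suc i) * (b - a) / real N) \<omega> - W (a + real i * (b - a) / real N) \<omega>))
         - I \<omega>))\<^sup>2) \<partial>M) \<longlonglongrightarrow> 0"

text \<open>The history of \<open>W\<close> up to time \<open>s\<close>, augmented by the null events.\<close>

definition history :: "'w measure \<Rightarrow> (real \<Rightarrow> 'w \<Rightarrow> real^'k) \<Rightarrow> real \<Rightarrow> 'w measure" where
  "history M W s = sigma (space M)
     ({W r -` A \<inter> space M |r A. r \<in> {0..s} \<and> A \<in> sets borel} \<union> null_sets M)"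

text \<open>The players are indexed by the finite type \<open>'n\<close>; the empirical measure is the uniform
  distribution on the \<open>n\<close> states, counted with multiplicity.\<close>

definition empirical :: "(real^'k)^'n \<Rightarrow> (real^'k) measure" where
  "empirical w = distr (uniform_count_measure UNIV) borel (\<lambda>i. w $ i)"

text \<open>The drift kernel has arguments \<open>t, x, u, w\<close>; the drift is its average over \<open>w\<close>.
  The deterministic path \<open>crowd\<close> of all players' states encodes the exogenous trajectory of
  empirical measures.\<close>

record ('w, 'k, 'p, 'n) player_problem =
  horizon :: real
  noise_level :: real
  risk_index :: real
  drift_kernel :: "real \<Rightarrow> real^'k::finite \<Rightarrow> real^'p::finite \<Rightarrow> real^'k \<Rightarrow> real^'k"
  volatility :: "real \<Rightarrow> real^'k^'k"
  running_cost :: "real \<Rightarrow> real^'k \<Rightarrow> real^'p \<Rightarrow> (real^'k) measure \<Rightarrow> real"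
  terminal_cost :: "real^'k \<Rightarrow> real"
  control_set :: "(real^'p) set"
  prob :: "'w measure"
  noise :: "'n::finite \<Rightarrow> real \<Rightarrow> 'w \<Rightarrow> real^'k"
  player :: 'n
  initial_state :: "real^'k"
  crowd :: "real \<Rightarrow> (real^'k)^'n"

definition mean_field ::
    "('w, 'k::finite, 'p::finite, 'n::finite) player_problem \<Rightarrow> real \<Rightarrow> (real^'k) measure" where
  "mean_field P t = empirical (crowd P t)"

definition drift ::
    "('w, 'k::finite, 'p::finite, 'n::finite) player_problem \<Rightarrow>
     real \<Rightarrow> real^'k \<Rightarrow> real^'p \<Rightarrow> (real^'k) measure \<Rightarrow> real^'k" where
  "drift P t x u m = (\<integral>w. drift_kernel P t x u w \<partial>m)"

text \<open>Regularity of the running cost in the measure means regularity in the \<open>n\<close> atoms of an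
  empirical measure.\<close>

definition standing_assumptions ::
    "('w, 'k::finite, 'p::finite, 'n::finite) player_problem \<Rightarrow> bool" where
  "standing_assumptions P \<longleftrightarrow>
    (let T = horizon P; f = drift_kernel P; c = running_cost P; g = terminal_cost P;
         \<sigma> = volatility P; U = control_set P; M = prob P
     in
      0 < T \<and> 0 < noise_level P \<and> 0 < risk_index P \<and>
      prob_space M \<and>
      (\<forall>i. standard_brownian_motion M (noise P i)) \<and>
      prob_space.indep_vars M (\<lambda>_. Pi\<^sub>M {0..} (\<lambda>_. borel))
        (\<lambda>i \<omega>. \<lambda>t\<in>{0..}. noise P i t \<omega>) UNIV \<and>
      continuous_on {0..T} (crowd P) \<and>
      U \<noteq> {} \<and> closed U \<and> bounded U \<and>
      C1_on ({0..T} \<times> UNIV \<times> U \<times> UNIV) (\<lambda>(t, x, u, w). f t x u w) \<and>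
      (\<exists>K. \<forall>t\<in>{0..T}. \<forall>x y w z. \<forall>u\<in>U. \<forall>u'\<in>U.
         norm (f t x u w - f t y u' z) \<le> K * (norm (x - y) + norm (u - u') + norm (w - z))) \<and>
      (\<exists>K. \<forall>t\<in>{0..T}. \<forall>x w. \<forall>u\<in>U. norm (f t x u w) \<le> K \<and>
         onorm (frechet_derivative (\<lambda>y. f t y u w) (at x)) \<le> K) \<and>
      C2_on {0..T} \<sigma> \<and>
      (\<forall>t\<in>{0..T}. \<forall>z. z \<noteq> 0 \<longrightarrow> 0 < z \<bullet> ((\<sigma> t ** transpose (\<sigma> t)) *v z)) \<and>
      C1_on ({0..T} \<times> UNIV \<times> U \<times> UNIV)
        (\<lambda>(t, x, u, w :: (real^'k)^'n). c t x u (empirical w)) \<and>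
      (\<exists>K. \<forall>t\<in>{0..T}. \<forall>x. \<forall>u\<in>U. \<forall>w :: (real^'k)^'n.
         0 \<le> c t x u (empirical w) \<and> c t x u (empirical w) \<le> K \<and>
         onorm (frechet_derivative (\<lambda>y. c t y u (empirical w)) (at x)) \<le> K) \<and>
      C2_on UNIV g \<and>
      (\<exists>K. \<forall>x. 0 \<le> g x \<and> g x \<le> K \<and> onorm (frechet_derivative g (at x)) \<le> K))"

text \<open>\<open>X\<close> solves the closed-loop state equation on the interval from \<open>t\<close> to the horizon, started
  at \<open>x\<close>.  Requiring every path (rather than almost every path) to be continuous makes the path
  integrals in the cost measurable without completing the probability space.\<close>

definition solves_state_equation ::
    "('w, 'k::finite, 'p::finite, 'n::finite) player_problem \<Rightarrow> (real \<Rightarrow> real^'k \<Rightarrow> real^'p) \<Rightarrow>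
     real \<Rightarrow> real^'k \<Rightarrow> (real \<Rightarrow> 'w \<Rightarrow> real^'k) \<Rightarrow> bool" where
  "solves_state_equation P \<gamma> t x X \<longleftrightarrow>
     (let M = prob P; W = noise P (player P) in
      (\<forall>\<omega>\<in>space M. continuous_on {t..horizon P} (\<lambda>s. X s \<omega>)) \<and>
      (\<forall>s\<in>{t..horizon P}.
         X s \<in> borel_measurable (history M W s) \<and>
         (\<exists>I. has_ito_integral M W (volatility P) t s I \<and>
            (AE \<omega> in M. X s \<omega> =
               x + integral {t..s} (\<lambda>r. drift P r (X r \<omega>) (\<gamma> r (X r \<omega>)) (mean_field P r))
                 + sqrt (noise_level P) *\<^sub>R I \<omega>))))"

definition uniquely_solvable ::
    "('w, 'k::finite, 'p::finite, 'n::finite) player_problem \<Rightarrow> (real \<Rightarrow> real^'k \<Rightarrow> real^'p) \<Rightarrow>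
     bool" where
  "uniquely_solvable P \<gamma> \<longleftrightarrow>
     (\<forall>t\<in>{0..horizon P}. \<forall>x.
        (\<exists>X. solves_state_equation P \<gamma> t x X) \<and>
        (\<forall>X Y. solves_state_equation P \<gamma> t x X \<and> solves_state_equation P \<gamma> t x Y \<longrightarrow>
           (AE \<omega> in prob P. \<forall>s\<in>{t..horizon P}. X s \<omega> = Y s \<omega>)))"

definition admissible ::
    "('w, 'k::finite, 'p::finite, 'n::finite) player_problem \<Rightarrow>
     (real \<Rightarrow> real^'k \<Rightarrow> real^'p) set" where
  "admissible P = {\<gamma>.
     (\<forall>t\<in>{0..horizon P}. \<forall>x. \<gamma> t x \<in> control_set P) \<and>
     (\<forall>x. piecewise_continuous_on_interval 0 (horizon P) (\<lambda>t. \<gamma> t x)) \<and>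
     (\<exists>K. \<forall>t\<in>{0..horizon P}. K-lipschitz_on UNIV (\<gamma> t)) \<and>
     uniquely_solvable P \<gamma>}"

text \<open>The expectation conditional on being in \<open>x\<close> at time \<open>t\<close> is the expectation over the solution
  started at \<open>x\<close> at time \<open>t\<close>; for admissible strategies it does not depend on the choice of the
  solution.\<close>

definition risk_sensitive_cost ::
    "('w, 'k::finite, 'p::finite, 'n::finite) player_problem \<Rightarrow> (real \<Rightarrow> real^'k \<Rightarrow> real^'p) \<Rightarrow>
     real \<Rightarrow> real^'k \<Rightarrow> real" where
  "risk_sensitive_cost P \<gamma> t x =
     (let X = (SOME X. solves_state_equation P \<gamma> t x X) in
      risk_index P * ln (\<integral>\<omega>. exp (1 / risk_index P *
        (terminal_cost P (X (horizon P) \<omega>) +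
         integral {t..horizon P}
           (\<lambda>s. running_cost P s (X s \<omega>) (\<gamma> s (X s \<omega>)) (mean_field P s)))) \<partial>prob P))"

definition best_response ::
    "('w, 'k::finite, 'p::finite, 'n::finite) player_problem \<Rightarrow> (real \<Rightarrow> real^'k \<Rightarrow> real^'p) \<Rightarrow>
     bool" where
  "best_response P \<gamma> \<longleftrightarrow>
     is_arg_min (\<lambda>\<gamma>. risk_sensitive_cost P \<gamma> 0 (initial_state P)) (\<lambda>\<gamma>. \<gamma> \<in> admissible P) \<gamma>"

definition value_function ::
    "('w, 'k::finite, 'p::finite, 'n::finite) player_problem \<Rightarrow> real \<Rightarrow> real^'k \<Rightarrow> real" where
  "value_function P t x = (INF \<gamma>\<in>admissible P. risk_sensitive_cost P \<gamma> t x)"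

definition hjb_expression ::
    "('w, 'k::finite, 'p::finite, 'n::finite) player_problem \<Rightarrow> (real \<Rightarrow> real^'k \<Rightarrow> real^'k) \<Rightarrow>
     (real \<Rightarrow> real^'k \<Rightarrow> real^'k^'k) \<Rightarrow> real \<Rightarrow> real^'k \<Rightarrow> real^'p \<Rightarrow> real" where
  "hjb_expression P vx vxx t x u =
     drift P t x u (mean_field P t) \<bullet> vx t x
     + noise_level P / 2 * trace (volatility P t ** transpose (volatility P t) ** vxx t x)
     + noise_level P / (2 * risk_index P) * (norm (transpose (volatility P t) *v vx t x))\<^sup>2
     + running_cost P t x u (mean_field P t)"

definition satisfies_hjb ::
    "('w, 'k::finite, 'p::finite, 'n::finite) player_problem \<Rightarrow> (real \<Rightarrow> real^'k \<Rightarrow> real) \<Rightarrow>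
     (real \<Rightarrow> real^'k \<Rightarrow> real) \<Rightarrow> (real \<Rightarrow> real^'k \<Rightarrow> real^'k) \<Rightarrow>
     (real \<Rightarrow> real^'k \<Rightarrow> real^'k^'k) \<Rightarrow> bool" where
  "satisfies_hjb P v vt vx vxx \<longleftrightarrow>
     (\<forall>t\<in>{0..horizon P}. \<forall>x.
        vt t x + (INF u\<in>control_set P. hjb_expression P vx vxx t x u) = 0) \<and>
     (\<forall>x. v (horizon P) x = terminal_cost P x)"

definition attains_hjb_minimum ::
    "('w, 'k::finite, 'p::finite, 'n::finite) player_problem \<Rightarrow> (real \<Rightarrow> real^'k \<Rightarrow> real^'k) \<Rightarrow>
     (real \<Rightarrow> real^'k \<Rightarrow> real^'k^'k) \<Rightarrow> (real \<Rightarrow> real^'k \<Rightarrow> real^'p) \<Rightarrow> bool" where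
  "attains_hjb_minimum P vx vxx \<gamma> \<longleftrightarrow>
     (\<forall>t\<in>{0..horizon P}. \<forall>x.
        is_arg_min (hjb_expression P vx vxx t x) (\<lambda>u. u \<in> control_set P) (\<gamma> t x))"

end

theory Submission
  imports Defs
begin

text \<open>The control enters the Hamilton--Jacobi--Bellman expression only through
  \<open>(B *v u) \<bullet> p + \<parallel>u\<parallel>\<^sup>2\<close>, where \<open>p\<close> is the gradient of the value function; the diffusion term and
  the risk-sensitive correction do not see it, because the volatility is uncontrolled.  Completing
  the square turns this into the squared distance of \<open>u\<close> from
  \<open>- (1/2) *\<^sub>R (transpose B *v p)\<close>, up to a constant (lemma
  \<open>hjb_expression_completed_square\<close>).  That point lies in the control set whenever the feedback
  built from it is admissible, and a squared distance from a point of the set is minimised over the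
  set at that point and nowhere else (lemma \<open>is_arg_min_dist_plus_const_iff\<close>).  So the feedback is
  the only one attaining the minimum, and it is a best response by verification.\<close>

lemma linear_plus_norm_square_completed:
  fixes A :: "real^'p^'k" and p :: "real^'k" and u :: "real^'p"
  defines "u0 \<equiv> - (1 / 2) *\<^sub>R (transpose A *v p)"
  shows "(A *v u) \<bullet> p + (norm u)\<^sup>2 = (norm (u - u0))\<^sup>2 - (norm u0)\<^sup>2"
proof -
  have "(A *v u) \<bullet> p = u \<bullet> (transpose A *v p)"
    by (metis dot_lmul_matrix inner_commute matrix_transpose_mul transpose_matrix_vector
        transpose_transpose)
  then show ?thesis
    by (simp add: u0_def power2_norm_eq_inner inner_simps inner_commute power_divide)
qed

text \<open>Because \<open>u0\<close> lies in \<open>U\<close>, the least possible distance is zero rather than the distance to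
  some projection, and only \<open>u0\<close> has distance zero.\<close>

lemma is_arg_min_dist_plus_const_iff:
  fixes u0 :: "'a::real_normed_vector"
  assumes "u0 \<in> U" and F: "\<And>u. u \<in> U \<Longrightarrow> F u = (norm (u - u0))\<^sup>2 + (r::real)"
  shows "is_arg_min F (\<lambda>u. u \<in> U) u \<longleftrightarrow> u = u0"
proof
  assume "is_arg_min F (\<lambda>u. u \<in> U) u"
  then have "u \<in> U" "\<not> F u0 < F u"
    using \<open>u0 \<in> U\<close> by (auto simp: is_arg_min_def)
  then show "u = u0"
    using F \<open>u0 \<in> U\<close> by simp
next
  assume "u = u0"
  then show "is_arg_min F (\<lambda>u. u \<in> U) u"
    using \<open>u0 \<in> U\<close> by (auto simp: is_arg_min_def F not_less)
qed

text \<open>The additive constant is hidden behind an existential whose scope contains the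
  quantifier over controls: it is the same for all of them, so it does not move the minimiser.\<close>

lemma hjb_expression_completed_square:
  fixes P :: "('w, 'k::finite, 'p::finite, 'n::finite) player_problem"
    and A :: "real^'p^'k"
  assumes drift: "\<And>u. u \<in> control_set P \<Longrightarrow> drift P t x u (mean_field P t) = a + A *v u"
    and cost: "\<And>u. u \<in> control_set P \<Longrightarrow>
      running_cost P t x u (mean_field P t) = b + (norm u)\<^sup>2"
  obtains r where "\<And>u. u \<in> control_set P \<Longrightarrow> hjb_expression P vx vxx t x u =
    (norm (u - (- (1 / 2) *\<^sub>R (transpose A *v vx t x))))\<^sup>2 + r"
proof
  fix u assume u: "u \<in> control_set P"
  show "hjb_expression P vx vxx t x u =
    (norm (u - (- (1 / 2) *\<^sub>R (transpose A *v vx t x))))\<^sup>2 +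
    (a \<bullet> vx t x
     + noise_level P / 2 * trace (volatility P t ** transpose (volatility P t) ** vxx t x)
     + noise_level P / (2 * risk_index P) * (norm (transpose (volatility P t) *v vx t x))\<^sup>2
     + b - (norm (- (1 / 2) *\<^sub>R (transpose A *v vx t x)))\<^sup>2)"
    using linear_plus_norm_square_completed[of A u "vx t x"]
    unfolding hjb_expression_def drift[OF u] cost[OF u] inner_add_left by linarith
qed

theorem proposition2:
  fixes P :: "('w, 'k::finite, 'p::finite, 'n::finite) player_problem"
    and fbar :: "real \<Rightarrow> real^'k \<Rightarrow> (real^'k) measure \<Rightarrow> real^'k"
    and B :: "real \<Rightarrow> real^'k \<Rightarrow> (real^'k) measure \<Rightarrow> real^'p^'k"
    and cbar :: "real \<Rightarrow> real^'k \<Rightarrow> (real^'k) measure \<Rightarrow> real"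
    and vt :: "real \<Rightarrow> real^'k \<Rightarrow> real"
    and vx :: "real \<Rightarrow> real^'k \<Rightarrow> real^'k"
    and vxx :: "real \<Rightarrow> real^'k \<Rightarrow> real^'k^'k"
    and \<gamma>star :: "real \<Rightarrow> real^'k \<Rightarrow> real^'p"
  assumes standing: "standing_assumptions P"
    and drift_affine: "\<And>t x u (w :: (real^'k)^'n). t \<in> {0..horizon P} \<Longrightarrow> u \<in> control_set P \<Longrightarrow>
      drift P t x u (empirical w) = fbar t x (empirical w) + B t x (empirical w) *v u"
    and cost_quadratic: "\<And>t x u (w :: (real^'k)^'n). t \<in> {0..horizon P} \<Longrightarrow> u \<in> control_set P \<Longrightarrow>
      running_cost P t x u (empirical w) = cbar t x (empirical w) + (norm u)\<^sup>2"
    and value_C2: "C12_with_derivatives (horizon P) (value_function P) vt vx vxx"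
    and hjb: "satisfies_hjb P (value_function P) vt vx vxx"
    and verification: "\<And>\<gamma>. \<gamma> \<in> admissible P \<Longrightarrow> attains_hjb_minimum P vx vxx \<gamma> \<Longrightarrow>
      best_response P \<gamma>"
    and \<gamma>star: "\<And>t x. t \<in> {0..horizon P} \<Longrightarrow>
      \<gamma>star t x = - (1 / 2) *\<^sub>R (transpose (B t x (mean_field P t)) *v vx t x)"
    and \<gamma>star_admissible: "\<gamma>star \<in> admissible P"
  shows "best_response P \<gamma>star \<and>
    attains_hjb_minimum P vx vxx \<gamma>star \<and>
    (\<forall>\<gamma>\<in>admissible P. attains_hjb_minimum P vx vxx \<gamma> \<longrightarrow>
       (\<forall>t\<in>{0..horizon P}. \<forall>x. \<gamma> t x = \<gamma>star t x))"
proof -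
  have control: "\<gamma>star t x \<in> control_set P" if "t \<in> {0..horizon P}" for t x
    using \<gamma>star_admissible that by (simp add: admissible_def)
  have minimiser: "is_arg_min (hjb_expression P vx vxx t x) (\<lambda>u. u \<in> control_set P) u
      \<longleftrightarrow> u = \<gamma>star t x" if t: "t \<in> {0..horizon P}" for t x u
  proof -
    obtain r where "\<And>u. u \<in> control_set P \<Longrightarrow>
      hjb_expression P vx vxx t x u = (norm (u - \<gamma>star t x))\<^sup>2 + r"
      using hjb_expression_completed_square
        [OF drift_affine[OF t, of _ x "crowd P t", folded mean_field_def]
          cost_quadratic[OF t, of _ x "crowd P t", folded mean_field_def], of vx vxx]
      unfolding \<gamma>star[OF t] by blast
    then show ?thesis
      by (rule is_arg_min_dist_plus_const_iff[OF control[OF t]])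
  qed
  then have attains: "attains_hjb_minimum P vx vxx \<gamma> \<longleftrightarrow>
      (\<forall>t\<in>{0..horizon P}. \<forall>x. \<gamma> t x = \<gamma>star t x)" for \<gamma>
    by (simp add: attains_hjb_minimum_def)
  then show ?thesis
    using verification[OF \<gamma>star_admissible] by simp
qed

end
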